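(* Let $n$ be a prime power, let $\mathrm{GF}(n)$ be the finite field of order $n$, and let $x$ be a generator of the multiplicative group of $\mathrm{GF}(n)$. Set $a_0=0$ and $a_i=x^{i-1}$ for $i=1,\dots,n-1$ (so $a_1=1$). For $1\le k\le n-1$ let $L_k$ be the $n\times n$ array, with rows and columns indexed by $0,\dots,n-1$ and entries in $\mathrm{GF}(n)$, whose entry in position $(i,j)$ is $a_i+a_k a_j$. Then $\{L_1,\dots,L_{n-1}\}$ is a set of $n-1$ mutually orthogonal Latin squares of order $n$ which is stepwise transitive.
   Context: A $k\times n$ Latin rectangle ($k\le n$) is a $k\times n$ array filled with $n$ symbols such that each row contains each symbol exactly once and each column contains each symbol at most once; for $k=n$ it is a Latin square. Two $k\times n$ Latin rectangles $A=(a_{ij})$, $B=(b_{ij})$ are orthogonal if each ordered pair $(a_{ij},b_{ij})$ occurs at most once. A $t$-MOLR of size $k\times n$ is a set of $t$ pairwise orthogonal $k\times n$ Latin rectangles. The isotopism group $G_{n,k,t}=S_t\times S_k\times S_n\times(S_n)^t$ acts on $t$-MOLR of size $k\times n$: $S_t$ permutes the rectangles, $S_k$ permutes the rows (simultaneously in all rectangles), $S_n$ permutes the columns (simultaneously in all rectangles), and the $i$-th factor of $(S_n)^t$ permutes the symbols within the $i$-th rectangle. The autotopism group $\mathrm{Aut}(A)$ of a $t$-MOLR $A$ is its stabilizer in $G_{n,k,t}$. A $t$-MOLR $A$ is transitive if $\mathrm{Aut}(A)$ acts transitively on the set of rectangles of $A$. A $k\times n$ $t$-MOLR $A$ is an extension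 of a $(k-1)\times n$ $t$-MOLR $B$ if $A$ results from $B$ by adding one more row to each rectangle (equivalently, $B$ is obtained from $A$ by deleting the same row from every rectangle). A $k\times n$ $t$-MOLR $A$ is stepwise transitive if $A$ is transitive and either $k=1$, or $k\ge 2$ and $A$ is an extension of a stepwise transitive $(k-1)\times n$ $t$-MOLR. *)

theory Defs
  imports
    "HOL-Algebra.Multiplicative_Group"
    "HOL-Combinatorics.Permutations"
    "HOL-Number_Theory.Prime_Powers"
begin

text \<open>
  A \<open>k \<times> n\<close> array is a function whose values at row indices \<open>i < k\<close> and column indices \<open>j < n\<close>
  matter; a family of \<open>t\<close> arrays is indexed by \<open>{1..t}\<close>. Values outside these ranges are
  irrelevant, so arrays are only ever compared inside them.
\<close>

type_synonym 'a array = "nat \<Rightarrow> nat \<Rightarrow> 'a"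
type_synonym 'a family = "nat \<Rightarrow> 'a array"

definition latin_rectangle :: "'a set \<Rightarrow> nat \<Rightarrow> nat \<Rightarrow> 'a array \<Rightarrow> bool" where
  "latin_rectangle S k n A \<longleftrightarrow>
     finite S \<and> card S = n \<and> k \<le> n \<and>
     (\<forall>i<k. \<forall>j<n. A i j \<in> S) \<and>
     (\<forall>i<k. \<forall>s\<in>S. \<exists>!j. j < n \<and> A i j = s) \<and>
     (\<forall>j<n. inj_on (\<lambda>i. A i j) {..<k})"

definition orthogonal_rectangles :: "nat \<Rightarrow> nat \<Rightarrow> 'a array \<Rightarrow> 'a array \<Rightarrow> bool" where
  "orthogonal_rectangles k n A B \<longleftrightarrow>
     inj_on (\<lambda>(i, j). (A i j, B i j)) ({..<k} \<times> {..<n})"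

text \<open>
  The third clause says that the \<open>t\<close> rectangles form a set of size \<open>t\<close>. It follows from
  orthogonality for \<open>k \<ge> 2\<close>, but not for \<open>k = 1\<close>, where every rectangle is orthogonal to itself.
\<close>

definition molr :: "'a set \<Rightarrow> nat \<Rightarrow> nat \<Rightarrow> nat \<Rightarrow> 'a family \<Rightarrow> bool" where
  "molr S t k n A \<longleftrightarrow>
     (\<forall>s\<in>{1..t}. latin_rectangle S k n (A s)) \<and>
     (\<forall>s\<in>{1..t}. \<forall>s'\<in>{1..t}. s \<noteq> s' \<longrightarrow> orthogonal_rectangles k n (A s) (A s')) \<and>
     (\<forall>s\<in>{1..t}. \<forall>s'\<in>{1..t}. s \<noteq> s' \<longrightarrow> (\<exists>i<k. \<exists>j<n. A s i j \<noteq> A s' i j))"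

abbreviation mols :: "'a set \<Rightarrow> nat \<Rightarrow> nat \<Rightarrow> 'a family \<Rightarrow> bool" where
  "mols S t n A \<equiv> molr S t n n A"

type_synonym 'a isotopism =
  "(nat \<Rightarrow> nat) \<times> (nat \<Rightarrow> nat) \<times> (nat \<Rightarrow> nat) \<times> (nat \<Rightarrow> 'a \<Rightarrow> 'a)"

definition isotopisms :: "'a set \<Rightarrow> nat \<Rightarrow> nat \<Rightarrow> nat \<Rightarrow> 'a isotopism set" where
  "isotopisms S t k n =
     {\<pi>. \<pi> permutes {1..t}} \<times> {\<rho>. \<rho> permutes {..<k}} \<times> {\<gamma>. \<gamma> permutes {..<n}} \<times>
     ({1..t} \<rightarrow>\<^sub>E {\<tau>. \<tau> permutes S})"

text \<open>
  The action moves the entry \<open>e\<close> in position \<open>(i, j)\<close> of the rectangle \<open>s\<close> to the entry \<open>\<sigma> s e\<close> in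
  position \<open>(\<rho> i, \<gamma> j)\<close> of the rectangle \<open>\<pi> s\<close>.
\<close>

definition isotopism_action :: "'a isotopism \<Rightarrow> 'a family \<Rightarrow> 'a family" where
  "isotopism_action g A =
     (case g of (\<pi>, \<rho>, \<gamma>, \<sigma>) \<Rightarrow>
       \<lambda>s i j. \<sigma> (inv_into UNIV \<pi> s)
                 (A (inv_into UNIV \<pi> s) (inv_into UNIV \<rho> i) (inv_into UNIV \<gamma> j)))"

definition autotopisms ::
    "'a set \<Rightarrow> nat \<Rightarrow> nat \<Rightarrow> nat \<Rightarrow> 'a family \<Rightarrow> 'a isotopism set" where
  "autotopisms S t k n A =
     {g \<in> isotopisms S t k n.
        \<forall>s\<in>{1..t}. \<forall>i<k. \<forall>j<n. isotopism_action g A s i j = A s i j}"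

text \<open>An autotopism with first component \<open>\<pi>\<close> maps the rectangle \<open>s\<close> to the rectangle \<open>\<pi> s\<close>.\<close>

definition transitive_molr :: "'a set \<Rightarrow> nat \<Rightarrow> nat \<Rightarrow> nat \<Rightarrow> 'a family \<Rightarrow> bool" where
  "transitive_molr S t k n A \<longleftrightarrow>
     molr S t k n A \<and>
     (\<forall>s\<in>{1..t}. \<forall>s'\<in>{1..t}. \<exists>g\<in>autotopisms S t k n A. fst g s = s')"

definition delete_row :: "nat \<Rightarrow> 'a array \<Rightarrow> 'a array" where
  "delete_row r A = (\<lambda>i j. A (if i < r then i else Suc i) j)"

definition is_extension :: "nat \<Rightarrow> nat \<Rightarrow> nat \<Rightarrow> 'a family \<Rightarrow> 'a family \<Rightarrow> bool" where
  "is_extension t k n A B \<longleftrightarrow>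
     (\<exists>r<k. \<forall>s\<in>{1..t}. \<forall>i<k - 1. \<forall>j<n. B s i j = delete_row r (A s) i j)"

inductive stepwise_transitive :: "'a set \<Rightarrow> nat \<Rightarrow> nat \<Rightarrow> nat \<Rightarrow> 'a family \<Rightarrow> bool"
  for S :: "'a set" and t :: nat where
  one_row: "transitive_molr S t 1 n A \<Longrightarrow> stepwise_transitive S t 1 n A"
| add_row: "transitive_molr S t k n A \<Longrightarrow> k \<ge> 2 \<Longrightarrow>
    stepwise_transitive S t (k - 1) n B \<Longrightarrow> is_extension t k n A B \<Longrightarrow>
    stepwise_transitive S t k n A"

definition field_elem :: "('a, 'b) ring_scheme \<Rightarrow> 'a \<Rightarrow> nat \<Rightarrow> 'a" where
  "field_elem R x i = (if i = 0 then \<zero>\<^bsub>R\<^esub> else x [^]\<^bsub>R\<^esub> (i - 1))"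

definition field_square :: "('a, 'b) ring_scheme \<Rightarrow> 'a \<Rightarrow> 'a family" where
  "field_square R x k i j =
     field_elem R x i \<oplus>\<^bsub>R\<^esub> field_elem R x k \<otimes>\<^bsub>R\<^esub> field_elem R x j"

end

theory Submission
  imports Defs
begin

text \<open>
  For a nonzero field element \<open>c\<close>, multiply the label of every square by \<open>c\<close> and that of every
  column by \<open>c\<^sup>-\<^sup>1\<close>, leaving rows and symbols alone. This preserves \<open>a\<^sub>i + a\<^sub>s a\<^sub>j\<close>, and such maps
  already act transitively on the squares. As they fix every row, they remain autotopisms of the
  rectangles formed by the first \<open>k\<close> rows, so rows can be deleted from the bottom one at a time.
\<close>

text \<open>With zero placed first, the indices \<open>1..n - 1\<close> label exactly the nonzero
  elements. The bijection with \<open>{..<n}\<close> also carries finiteness and cardinality of the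
  field.\<close>

locale enumerated_field = field R for R (structure) +
  fixes n :: nat and e :: "nat \<Rightarrow> 'a"
  assumes bij_e: "bij_betw e {..<n} (carrier R)"
    and e_0: "e 0 = \<zero>"
begin

definition square :: "'a family" where
  "square s i j = e i \<oplus> e s \<otimes> e j"

lemma e_closed: "i < n \<Longrightarrow> e i \<in> carrier R"
  using bij_e by (auto dest: bij_betwE)

lemma e_eq_iff: "i < n \<Longrightarrow> j < n \<Longrightarrow> e i = e j \<longleftrightarrow> i = j"
  using bij_e by (auto simp: bij_betw_def inj_on_def)

lemma e_surj: "y \<in> carrier R \<Longrightarrow> \<exists>i<n. e i = y"
  using bij_e unfolding bij_betw_def by (metis imageE lessThan_iff)

lemma finite_carrier: "finite (carrier R)"
  using bij_e by (auto dest: bij_betw_finite)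

lemma card_carrier: "card (carrier R) = n"
  using bij_betw_same_card[OF bij_e] by simp

lemma e_eq_0_iff: "i < n \<Longrightarrow> e i = \<zero> \<longleftrightarrow> i = 0"
  using e_eq_iff[of i 0] e_0 by auto

text \<open>As \<open>e s\<close> is invertible, the column of a symbol \<open>y\<close> in row
  \<open>i\<close> is the unique solution of a linear equation. Within a column, additive
  cancellation separates the rows.\<close>

lemma latin_rectangle_square:
  assumes "s \<in> {1..n - 1}" and "k \<le> n"
  shows "latin_rectangle (carrier R) k n (square s)"
proof -
  have s: "e s \<in> carrier R" "e s \<noteq> \<zero>"
    using assms e_closed e_eq_0_iff by auto
  have "\<exists>!j. j < n \<and> square s i j = y" if "i < k" and y: "y \<in> carrier R" for i y
  proof -
    have i: "e i \<in> carrier R"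
      using that assms e_closed by auto
    have *: "square s i j = y \<longleftrightarrow> e j = inv (e s) \<otimes> (y \<ominus> e i)" if "j < n" for j
    proof -
      have j: "e j \<in> carrier R"
        using that e_closed by auto
      have inv: "inv (e s) \<in> carrier R" "inv (e s) \<otimes> e s = \<one>" "e s \<otimes> inv (e s) = \<one>"
        using s field_Units by auto
      have "e j = inv (e s) \<otimes> (y \<ominus> e i)" if "square s i j = y"
      proof -
        have "y \<ominus> e i = e s \<otimes> e j"
          using that[symmetric] i s j unfolding square_def by algebra
        then show ?thesis
          using inv s j by (simp add: m_assoc[symmetric])
      qed
      moreover have "square s i j = y" if "e j = inv (e s) \<otimes> (y \<ominus> e i)"
      proof -
        have "e s \<otimes> e j = y \<ominus> e i"
          using that inv s i y by (simp add: m_assoc[symmetric])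
        then show ?thesis
          using i y unfolding square_def by algebra
      qed
      ultimately show ?thesis
        by blast
    qed
    have "inv (e s) \<otimes> (y \<ominus> e i) \<in> carrier R"
      using s i y field_Units by auto
    then show ?thesis
      using * e_surj e_eq_iff by metis
  qed
  moreover have "inj_on (\<lambda>i. square s i j) {..<k}" if "j < n" for j
    using that assms s by (auto simp: inj_on_def square_def e_closed e_eq_iff)
  ultimately show ?thesis
    using assms s e_closed
    by (auto simp: latin_rectangle_def finite_carrier card_carrier square_def)
qed

text \<open>Subtracting the two coordinate equations removes the row terms and leaves a vanishing
  product of a label difference and a column difference. The label difference is nonzero, so the
  columns agree, and then so do the rows.\<close>

lemma orthogonal_rectangles_square:
  assumes "s \<in> {1..n - 1}" and "s' \<in> {1..n - 1}" and "s \<noteq> s'" and "k \<le> n"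
  shows "orthogonal_rectangles k n (square s) (square s')"
  unfolding orthogonal_rectangles_def
proof (rule inj_onI, clarsimp)
  fix i j i' j'
  assume less: "i < k" "j < n" "i' < k" "j' < n"
    and eq: "square s i j = square s i' j'" "square s' i j = square s' i' j'"
  have closed: "e i \<in> carrier R" "e j \<in> carrier R" "e i' \<in> carrier R" "e j' \<in> carrier R"
    "e s \<in> carrier R" "e s' \<in> carrier R"
    using less assms e_closed by auto
  have "(e s \<ominus> e s') \<otimes> (e j \<ominus> e j')
      = (square s i j \<ominus> square s i' j') \<ominus> (square s' i j \<ominus> square s' i' j')"
    using closed unfolding square_def by algebra
  also have "\<dots> = \<zero>"
    using closed unfolding eq unfolding square_def by algebra
  finally have "e s \<ominus> e s' = \<zero> \<or> e j \<ominus> e j' = \<zero>"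
    using closed by (simp add: integral_iff)
  then have "j = j'"
    using closed less assms by (auto simp: e_eq_iff)
  then show "i = i' \<and> j = j'"
    using eq(1) closed less assms by (auto simp: square_def e_eq_iff)
qed

lemma molr_square:
  assumes "1 \<le> k" and "k \<le> n"
  shows "molr (carrier R) (n - 1) k n square"
proof -
  have "\<exists>i<k. \<exists>j<n. square s i j \<noteq> square s' i j"
    if "s \<in> {1..n - 1}" "s' \<in> {1..n - 1}" "s \<noteq> s'" for s s'
  proof -
    \<comment> \<open>In row 0 the column labelled by one contains the label \<open>e s\<close>
      itself. This separates the squares even for \<open>k = 1\<close>, where orthogonality does
      not.\<close>
    obtain j where j: "j < n" "e j = \<one>"
      using e_surj by blast
    then have "square s 0 j \<noteq> square s' 0 j"
      using that by (auto simp: square_def e_0 e_closed e_eq_iff)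
    then show ?thesis
      using assms j by (intro exI[of _ 0] exI[of _ j] conjI) auto
  qed
  then show ?thesis
    using assms by (simp add: molr_def latin_rectangle_square orthogonal_rectangles_square)
qed

text \<open>Multiplication by \<open>c\<close>, transported to indices along \<open>e\<close>. It is
  the identity from \<open>n\<close> on because \<open>permutes\<close> demands that outside its
  set.\<close>

definition mult_index :: "'a \<Rightarrow> nat \<Rightarrow> nat" where
  "mult_index c i = (if i < n then inv_into {..<n} e (c \<otimes> e i) else i)"

lemma mult_index:
  assumes "c \<in> carrier R" and "i < n"
  shows "mult_index c i < n" and "e (mult_index c i) = c \<otimes> e i"
proof -
  have "c \<otimes> e i \<in> e ` {..<n}"
    using assms e_closed bij_e by (auto simp: bij_betw_def)
  then show "mult_index c i < n" and "e (mult_index c i) = c \<otimes> e i"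
    using assms inv_into_into[of "c \<otimes> e i" e "{..<n}"]
    by (auto simp: mult_index_def f_inv_into_f)
qed

lemma mult_index_permutes:
  assumes c: "c \<in> carrier R" "c \<noteq> \<zero>"
  shows "mult_index c permutes {..<n}"
proof (rule bij_imp_permutes)
  have "inj_on (mult_index c) {..<n}"
  proof (rule inj_onI)
    fix i j assume *: "i \<in> {..<n}" "j \<in> {..<n}" "mult_index c i = mult_index c j"
    then have "c \<otimes> e i = c \<otimes> e j"
      using c mult_index(2) by (metis lessThan_iff)
    then show "i = j"
      using * c by (auto simp: m_lcancel e_closed e_eq_iff)
  qed
  moreover have "mult_index c ` {..<n} \<subseteq> {..<n}"
    using c mult_index(1) by auto
  ultimately show "bij_betw (mult_index c) {..<n} {..<n}"
    by (simp add: bij_betw_def endo_inj_surj)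
qed (simp add: mult_index_def)

text \<open>Multiplication fixes zero, hence index 0, so the same map also permutes the labels of
  the squares.\<close>

lemma mult_index_permutes_nonzero:
  assumes c: "c \<in> carrier R" "c \<noteq> \<zero>"
  shows "mult_index c permutes {1..n - 1}"
proof (rule permutes_superset[OF mult_index_permutes[OF c]])
  fix i assume "i \<in> {..<n} - {1..n - 1}"
  then have "i = 0" "0 < n"
    by auto
  moreover from this have "e (mult_index c 0) = \<zero>" "mult_index c 0 < n"
    using c mult_index[of c 0] by (auto simp: e_0)
  ultimately show "mult_index c i = i"
    by (simp add: e_eq_0_iff)
qed

lemma transitive_molr_square:
  assumes "1 \<le> k" and "k \<le> n"
  shows "transitive_molr (carrier R) (n - 1) k n square"
proof -
  have "\<exists>g\<in>autotopisms (carrier R) (n - 1) k n square. fst g s = s'"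
    if s: "s \<in> {1..n - 1}" "s' \<in> {1..n - 1}" for s s'
  proof -
    have es: "e s \<in> carrier R" "e s \<noteq> \<zero>" "e s' \<in> carrier R" "e s' \<noteq> \<zero>"
      using s e_closed e_eq_0_iff by auto
    \<comment> \<open>Multiplication by \<open>c\<close> takes the label \<open>e s\<close> to
      \<open>e s'\<close>, and \<open>d\<close> is the inverse of \<open>c\<close>.\<close>
    define c d where "c = e s' \<otimes> inv (e s)" and "d = e s \<otimes> inv (e s')"
    have inv: "inv (e s) \<in> carrier R" "inv (e s) \<otimes> e s = \<one>"
      "inv (e s') \<in> carrier R" "inv (e s') \<otimes> e s' = \<one>"
      using es field_Units by auto
    have cd: "c \<in> carrier R" "d \<in> carrier R"
      using es inv by (auto simp: c_def d_def)
    have "c \<otimes> d = (inv (e s) \<otimes> e s) \<otimes> (inv (e s') \<otimes> e s')"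
      using es(1,3) inv(1,3) unfolding c_def d_def by algebra
    then have cd_1: "c \<otimes> d = \<one>"
      by (simp add: inv)
    then have nz: "c \<noteq> \<zero>" "d \<noteq> \<zero>"
      using cd by auto
    let ?\<pi> = "mult_index c" and ?\<gamma> = "mult_index d"
    \<comment> \<open>The symbol component is restricted because \<open>isotopisms\<close> takes it
      from an extensional function space. Evaluating the action therefore needs that the preimage of
      a label is again a label.\<close>
    let ?g = "(?\<pi>, id, ?\<gamma>, \<lambda>u\<in>{1..n - 1}. id)"
    have \<pi>: "?\<pi> permutes {1..n - 1}" and \<gamma>: "?\<gamma> permutes {..<n}"
      using mult_index_permutes_nonzero mult_index_permutes cd nz by blast+
    have "isotopism_action ?g square u i j = square u i j"
      if uij: "u \<in> {1..n - 1}" "i < k" "j < n" for u i j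
    proof -
      \<comment> \<open>The action reads its entry at the preimages. Passing back to
        \<open>u\<close> and \<open>j\<close> multiplies label and column by \<open>c\<close> and
        \<open>d\<close>, which cancel in the product.\<close>
      define u' j' where "u' = inv_into UNIV ?\<pi> u" and "j' = inv_into UNIV ?\<gamma> j"
      have u': "u' \<in> {1..n - 1}" "?\<pi> u' = u"
        using permutes_in_image[OF permutes_inv[OF \<pi>]] permutes_inverses(1)[OF \<pi>] uij
        by (auto simp: u'_def)
      have j': "j' < n" "?\<gamma> j' = j"
        using permutes_in_image[OF permutes_inv[OF \<gamma>]] permutes_inverses(1)[OF \<gamma>] uij
        by (auto simp: j'_def)
      have closed: "e u' \<in> carrier R" "e j' \<in> carrier R"
        using u' j' e_closed by auto
      have "e u = c \<otimes> e u'" "e j = d \<otimes> e j'"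
        using mult_index(2)[of c u'] mult_index(2)[of d j'] cd u' j' by auto
      then have "e u \<otimes> e j = (c \<otimes> d) \<otimes> (e u' \<otimes> e j')"
        using cd closed by (simp add: m_ac)
      then have "e u \<otimes> e j = e u' \<otimes> e j'"
        using closed by (simp add: cd_1)
      then show ?thesis
        using u'(1) by (simp add: isotopism_action_def square_def flip: u'_def j'_def)
    qed
    moreover have "?g \<in> isotopisms (carrier R) (n - 1) k n"
      using \<pi> \<gamma> by (auto simp: isotopisms_def)
    moreover have "?\<pi> s = s'"
    proof -
      have "e (?\<pi> s) = e s'"
        using mult_index(2)[of c s] cd s es inv by (auto simp: c_def m_assoc)
      then show ?thesis
        using mult_index(1)[of c s] cd s by (auto simp: e_eq_iff)
    qed
    ultimately show ?thesis
      by (intro bexI[of _ ?g]) (auto simp: autotopisms_def)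
  qed
  then show ?thesis
    unfolding transitive_molr_def using molr_square[OF assms] by blast
qed

lemma stepwise_transitive_square:
  assumes "1 \<le> k" and "k \<le> n"
  shows "stepwise_transitive (carrier R) (n - 1) k n square"
  using assms
proof (induction k rule: nat_induct_at_least)
  case base
  then show ?case
    by (intro one_row transitive_molr_square) simp_all
next
  case (Suc k)
  have "transitive_molr (carrier R) (n - 1) (Suc k) n square"
    using Suc by (intro transitive_molr_square) auto
  \<comment> \<open>The deleted row is the last one, so the rows before it keep their indices and
    the same function \<open>square\<close> represents the smaller family.\<close>
  moreover have "is_extension (n - 1) (Suc k) n square square"
    unfolding is_extension_def by (rule exI[of _ k]) (simp add: delete_row_def)
  ultimately show ?case
    using Suc by (auto intro: add_row[where B = square])
qed

end

text \<open>The generator has order \<open>order R - 1\<close>, so its powers below that exponent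
  are distinct, and none is zero. An injection between finite sets of equal size is onto.\<close>

lemma bij_betw_field_elem:
  assumes "field R" and fin: "finite (carrier R)"
    and x: "x \<in> carrier (mult_of R)" and gen: "generate (mult_of R) {x} = carrier (mult_of R)"
  shows "bij_betw (field_elem R x) {..<order R} (carrier R)"
proof -
  interpret field R by fact
  interpret M: group "mult_of R" by (rule field_mult_group)
  have ord: "M.ord x = order R - 1"
    using M.generate_pow_card[OF x] fin by (simp add: gen order_def)
  have "inj_on (field_elem R x) {..<order R}"
  proof (rule inj_onI)
    fix i j assume *: "i \<in> {..<order R}" "j \<in> {..<order R}" "field_elem R x i = field_elem R x j"
    have nz: "x [^]\<^bsub>R\<^esub> m \<noteq> \<zero>\<^bsub>R\<^esub>" for m :: nat
      using M.nat_pow_closed[OF x, of m] by (simp add: nat_pow_mult_of)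
    show "i = j"
    proof (cases "i = 0 \<or> j = 0")
      case True
      then show ?thesis
        using *(3) nz[symmetric] nz by (auto simp: field_elem_def split: if_splits)
    next
      case False
      \<comment> \<open>For nonzero indices below \<open>order R\<close>, both exponents are at most
        \<open>M.ord x - 1\<close>, the range on which \<open>M.ord_inj\<close> gives
        injectivity.\<close>
      then have "i - 1 = j - 1"
        using * M.ord_inj[OF x] by (auto simp: inj_on_def field_elem_def ord nat_pow_mult_of)
      then show ?thesis
        using False by auto
    qed
  qed
  moreover have "field_elem R x ` {..<order R} \<subseteq> carrier R"
    using x by (auto simp: field_elem_def)
  ultimately show ?thesis
    using fin by (simp add: bij_betw_def card_image card_subset_eq order_def)
qed

theorem theorem1:
  fixes R :: "('a, 'b) ring_scheme" and n :: nat and x :: 'a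
  assumes "primepow n"
    and "field R" and "order R = n"
    and "x \<in> carrier (mult_of R)" and "generate (mult_of R) {x} = carrier (mult_of R)"
  shows "mols (carrier R) (n - 1) n (field_square R x) \<and>
         stepwise_transitive (carrier R) (n - 1) n n (field_square R x)"
proof -
  interpret field R by fact
  have "0 < n"
    using assms(1) by (rule primepow_gt_0_nat)
  \<comment> \<open>An infinite carrier would have \<open>order R = 0\<close>.\<close>
  then have "finite (carrier R)"
    using assms(3) order_gt_0_iff_finite by blast
  then have "bij_betw (field_elem R x) {..<n} (carrier R)"
    using bij_betw_field_elem[OF assms(2)] assms(3-5) by blast
  then interpret enumerated_field R n "field_elem R x"
    by (intro enumerated_field.intro enumerated_field_axioms.intro assms(2))
      (simp_all add: field_elem_def)
  have "square = field_square R x"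
    by (intro ext) (simp add: square_def field_square_def)
  then show ?thesis
    using molr_square[of n] stepwise_transitive_square[of n] \<open>0 < n\<close> by auto
qed

end
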